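(* Let $G=(V,E)$ be a finite digraph with minimum out-degree at least $15$. Then there exists $u\in V$ such that for every $w\in V\setminus\{u\}$ there exists a friendly partition of $G$ that separates $u$ and $w$ (i.e. $u$ and $w$ lie in different parts).
   Context: Digraphs have no loops and no parallel arcs in the same direction. A friendly partition of a digraph $G=(V,E)$ is a partition $\{V_1,V_2\}$ of $V$ into two nonempty sets such that every vertex has at least one out-neighbor in its own part. *)

theory Defs
  imports "Graph_Theory.Digraph" "HOL-Library.Disjoint_Sets"
begin

definition friendly_partition :: "('a, 'b) pre_digraph \<Rightarrow> 'a set set \<Rightarrow> bool" where
  "friendly_partition G P \<longleftrightarrow>
     partition_on (verts G) P \<and> card P = 2 \<and>
     (\<forall>X\<in>P. \<forall>v\<in>X. \<exists>x\<in>X. v \<rightarrow>\<^bsub>G\<^esub> x)"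

definition separates :: "'a set set \<Rightarrow> 'a \<Rightarrow> 'a \<Rightarrow> bool" where
  "separates P u w \<longleftrightarrow> (\<exists>X\<in>P. \<exists>Y\<in>P. X \<noteq> Y \<and> u \<in> X \<and> w \<in> Y)"

end

theory Submission
  imports Defs
begin

text \<open>
  Call a set friendly if each of its vertices has an out-neighbour in it. It suffices to find a
  vertex \<open>u\<close> and two disjoint friendly sets avoiding \<open>u\<close>, both containing out-neighbours of \<open>u\<close>:
  they extend to a partition of the remaining vertices, and \<open>u\<close> can then join either part.

  In a minimal counterexample with all out-degrees 15, a nonempty friendly set \<open>C\<close> has at least 14
  vertices, since otherwise any \<open>u\<close> with an arc into \<open>C\<close> works with \<open>C\<close> and its complement.
  Contracting an arc must destroy an out-degree, so the ends of each arc have a common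
  in-neighbour; hence every in-neighbourhood contains a friendly set and every in-degree is at
  least 14. Friendly sets with 14 vertices have in-degrees so large that counting arcs excludes
  them. Then all in-degrees are 15 and every in-neighbourhood is an induced 15-cycle, which is
  too rigid for the vertices sending arcs into one such cycle.
\<close>

section \<open>Friendly sets\<close>

definition friendly :: "('a \<Rightarrow> 'a set) \<Rightarrow> 'a set \<Rightarrow> bool" where
  "friendly N A \<longleftrightarrow> (\<forall>a\<in>A. N a \<inter> A \<noteq> {})"

text \<open>Unions of friendly sets are friendly, so this is the largest friendly subset of
  \<open>X\<close>.\<close>

definition core :: "('a \<Rightarrow> 'a set) \<Rightarrow> 'a set \<Rightarrow> 'a set" where
  "core N X = \<Union>{A. A \<subseteq> X \<and> friendly N A}"

lemma core_subset: "core N X \<subseteq> X"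
  by (auto simp: core_def)

lemma friendly_core: "friendly N (core N X)"
  unfolding friendly_def core_def by blast

lemma core_greatest: "A \<subseteq> X \<Longrightarrow> friendly N A \<Longrightarrow> A \<subseteq> core N X"
  by (auto simp: core_def)

lemma core_absorbs:
  assumes "v \<in> X" "N v \<inter> core N X \<noteq> {}"
  shows "v \<in> core N X"
proof -
  have "friendly N (insert v (core N X))"
    using friendly_core[of N X] assms(2) unfolding friendly_def by blast
  then show ?thesis
    using core_greatest[of "insert v (core N X)" X N] core_subset[of N X] assms(1) by blast
qed

text \<open>A friendly \<open>Z\<close> would lie in the core. Hence the vertices outside the core
  can be peeled off sink by sink.\<close>

lemma sink_outside_core:
  assumes "Z \<subseteq> X - core N X" "Z \<noteq> {}"
  obtains z where "z \<in> Z" "N z \<inter> Z = {}"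
proof -
  have "\<not> friendly N Z"
    using core_greatest[of Z X N] assms by blast
  then show thesis
    using that unfolding friendly_def by blast
qed

section \<open>In-neighbours and minimal friendly sets\<close>

text \<open>Choose an in-neighbour \<open>g x\<close> in \<open>X\<close> for each \<open>x\<close>.
  If \<open>g\<close> is onto, every vertex is some \<open>g x\<close> and has the out-neighbour
  \<open>x\<close>; otherwise \<open>g\<close> maps its image into itself and induction applies to
  that smaller set.\<close>

lemma friendly_subset_of_in_neighbours:
  assumes "finite X" "X \<noteq> {}" "\<And>x. x \<in> X \<Longrightarrow> \<exists>z\<in>X. x \<in> N z"
  shows "\<exists>Y\<subseteq>X. Y \<noteq> {} \<and> friendly N Y"
  using assms
proof (induction X rule: finite_psubset_induct)
  case (psubset X)
  obtain g where g: "\<And>x. x \<in> X \<Longrightarrow> g x \<in> X \<and> x \<in> N (g x)"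
    using psubset.prems(2) by metis
  show ?case
  proof (cases "g ` X = X")
    case True
    have "friendly N X"
      unfolding friendly_def
    proof
      fix a assume "a \<in> X"
      then obtain x where "x \<in> X" "a = g x" using True by blast
      then show "N a \<inter> X \<noteq> {}" using g by blast
    qed
    then show ?thesis using psubset.prems(1) by blast
  next
    case False
    then have sub: "g ` X \<subset> X" using g by blast
    have "\<exists>Y\<subseteq>g ` X. Y \<noteq> {} \<and> friendly N Y"
    proof (rule psubset.IH[OF sub])
      show "g ` X \<noteq> {}" using psubset.prems(1) by blast
      show "\<exists>z\<in>g ` X. x \<in> N z" if "x \<in> g ` X" for x
        using that g by blast
    qed
    then obtain Y where "Y \<subseteq> g ` X" "Y \<noteq> {}" "friendly N Y" by blast
    moreover have "g ` X \<subseteq> X" using sub by (rule psubset_imp_subset)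
    ultimately show ?thesis by (intro exI[of _ Y]) simp
  qed
qed

text \<open>Deleting a vertex without in-neighbours in \<open>D\<close> would leave a smaller
  friendly set, nonempty because it contains an out-neighbour of \<open>x\<close>.\<close>

lemma in_neighbour_in_minimal_friendly:
  assumes "friendly N D" "x \<in> D"
    and min: "\<And>Y. Y \<subset> D \<Longrightarrow> Y \<noteq> {} \<Longrightarrow> \<not> friendly N Y"
    and "x \<notin> N x"
  shows "\<exists>z\<in>D. x \<in> N z"
proof (rule ccontr)
  assume none: "\<not> ?thesis"
  obtain y where y: "y \<in> N x" "y \<in> D" using assms(1,2) unfolding friendly_def by blast
  have "friendly N (D - {x})"
    using assms(1) none unfolding friendly_def by blast
  then show False using min[of "D - {x}"] assms(2,4) y by blast
qed

text \<open>If \<open>x\<close> had two in-neighbours, one could be deleted with every remaining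
  vertex keeping an in-neighbour, which yields a smaller friendly set. With the preceding lemma, a
  minimal nonempty friendly set induces a directed cycle.\<close>

lemma unique_in_neighbour_in_minimal_friendly:
  assumes fin: "finite D" and fr: "friendly N D"
    and min: "\<And>Y. Y \<subset> D \<Longrightarrow> Y \<noteq> {} \<Longrightarrow> \<not> friendly N Y"
    and irr: "\<And>x. x \<in> D \<Longrightarrow> x \<notin> N x"
    and x: "x \<in> D" and ab: "a \<in> D" "b \<in> D" "x \<in> N a" "x \<in> N b"
  shows "a = b"
proof (rule ccontr)
  assume neq: "a \<noteq> b"
  have "\<forall>v\<in>D. \<exists>z\<in>D. v \<in> N z"
    using in_neighbour_in_minimal_friendly[OF fr _ min] irr by blast
  then obtain g0 where g0: "\<And>v. v \<in> D \<Longrightarrow> g0 v \<in> D \<and> v \<in> N (g0 v)" by metis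
  define g where "g = g0(x := a)"
  have g: "g v \<in> D \<and> v \<in> N (g v)" if "v \<in> D" for v
    using g0 ab that by (auto simp: g_def)
  \<comment> \<open>A choice of in-neighbours must be onto, since its image would otherwise contain
    a smaller friendly set.\<close>
  have "g ` D = D"
  proof (rule ccontr)
    assume "g ` D \<noteq> D"
    then have sub: "g ` D \<subset> D" using g by blast
    have "\<exists>Y\<subseteq>g ` D. Y \<noteq> {} \<and> friendly N Y"
      by (rule friendly_subset_of_in_neighbours) (use fin x g in auto)
    then obtain Y where Y: "Y \<subseteq> g ` D" "Y \<noteq> {}" "friendly N Y" by blast
    have "Y \<subset> D" using Y(1) sub by (rule subset_psubset_trans)
    then show False using min[OF _ Y(2)] Y(3) by blast
  qed
  then have inj: "inj_on g D" using fin by (simp add: eq_card_imp_inj_on)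
  \<comment> \<open>By injectivity \<open>a\<close> is chosen only for \<open>x\<close>, and
    \<open>x\<close> still has \<open>b\<close>.\<close>
  have "\<exists>Y\<subseteq>D - {a}. Y \<noteq> {} \<and> friendly N Y"
  proof (rule friendly_subset_of_in_neighbours)
    show "finite (D - {a})" using fin by blast
    show "D - {a} \<noteq> {}" using ab neq by blast
    fix v assume v: "v \<in> D - {a}"
    show "\<exists>z\<in>D - {a}. v \<in> N z"
    proof (cases "v = x")
      case True
      then show ?thesis using ab neq by blast
    next
      case False
      then have "g v \<noteq> g x" using inj v x by (auto dest: inj_onD)
      then have "g v \<noteq> a" by (simp add: g_def)
      then show ?thesis using g v by blast
    qed
  qed
  then obtain Y where Y: "Y \<subseteq> D - {a}" "Y \<noteq> {}" "friendly N Y" by blast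
  have "Y \<subset> D" using Y(1) ab(1) by blast
  then show False using min[OF _ Y(2)] Y(3) by blast
qed

section \<open>Splittings and their transfer between digraphs\<close>

text \<open>The two sets need not cover \<open>V - {u}\<close>, so a splitting survives adding
  vertices and arcs; \<open>extend_friendly_pair\<close> enlarges them to a partition in the
  end.\<close>

definition splittable :: "'a set \<Rightarrow> ('a \<Rightarrow> 'a set) \<Rightarrow> bool" where
  "splittable V N \<longleftrightarrow> (\<exists>u\<in>V. \<exists>A B. A \<subseteq> V - {u} \<and> B \<subseteq> V - {u} \<and> A \<inter> B = {} \<and>
     friendly N A \<and> friendly N B \<and> N u \<inter> A \<noteq> {} \<and> N u \<inter> B \<noteq> {})"

lemma splittableI:
  assumes "u \<in> V" "A \<subseteq> V - {u}" "B \<subseteq> V - {u}" "A \<inter> B = {}" "friendly N A" "friendly N B"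
    "N u \<inter> A \<noteq> {}" "N u \<inter> B \<noteq> {}"
  shows "splittable V N"
  unfolding splittable_def
  by (rule bexI[OF _ assms(1)], rule exI[of _ A], rule exI[of _ B]) (intro conjI assms)

lemma friendly_mono: "friendly N' A \<Longrightarrow> (\<And>a. a \<in> A \<Longrightarrow> N' a \<subseteq> N a) \<Longrightarrow> friendly N A"
  unfolding friendly_def by blast

lemma splittable_mono:
  assumes "splittable V' N'" "V' \<subseteq> V" and sub: "\<And>v. v \<in> V' \<Longrightarrow> N' v \<subseteq> N v"
  shows "splittable V N"
proof -
  obtain u A B where u: "u \<in> V'" "A \<subseteq> V' - {u}" "B \<subseteq> V' - {u}" "A \<inter> B = {}"
    "friendly N' A" "friendly N' B" "N' u \<inter> A \<noteq> {}" "N' u \<inter> B \<noteq> {}"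
    using assms(1) unfolding splittable_def by blast
  have "friendly N A" "friendly N B"
    using friendly_mono[of N' _ N] u sub by blast+
  moreover have "N u \<inter> A \<noteq> {}" "N u \<inter> B \<noteq> {}" using u sub by blast+
  moreover have "u \<in> V" "A \<subseteq> V - {u}" "B \<subseteq> V - {u}" using u assms(2) by blast+
  ultimately show ?thesis using splittableI u(4) by metis
qed

text \<open>A retraction moving vertices only along arcs is a simultaneous contraction of arcs.\<close>

lemma splittable_retraction:
  assumes "splittable V' N'" "V' \<subseteq> V"
    and id: "\<And>v. v \<in> V' \<Longrightarrow> \<phi> v = v"
    and arc: "\<And>x. x \<in> V - V' \<Longrightarrow> \<phi> x \<in> N x \<inter> V'"
    and N': "\<And>v. v \<in> V' \<Longrightarrow> N' v \<subseteq> \<phi> ` N v"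
    and NV: "\<And>v. v \<in> V \<Longrightarrow> N v \<subseteq> V"
  shows "splittable V N"
proof -
  obtain u A B where u: "u \<in> V'" "A \<subseteq> V' - {u}" "B \<subseteq> V' - {u}" "A \<inter> B = {}"
    "friendly N' A" "friendly N' B" "N' u \<inter> A \<noteq> {}" "N' u \<inter> B \<noteq> {}"
    using assms(1) unfolding splittable_def by blast
  define lift where "lift X = {v \<in> V. \<phi> v \<in> X}" for X
  have meets: "N v \<inter> lift X \<noteq> {}" if "v \<in> V'" "N' v \<inter> X \<noteq> {}" for v X
    using that N' NV \<open>V' \<subseteq> V\<close> unfolding lift_def by blast
  have fr: "friendly N (lift X)" if "friendly N' X" "X \<subseteq> V'" for X
    unfolding friendly_def
  proof
    fix a assume a: "a \<in> lift X"
    show "N a \<inter> lift X \<noteq> {}"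
    proof (cases "a \<in> V'")
      case True
      then have "a \<in> X" using a id by (simp add: lift_def)
      then show ?thesis using that True meets unfolding friendly_def by blast
    next
      case False
      \<comment> \<open>A contracted vertex uses the arc to its image, which \<open>\<phi>\<close>
        fixes and which therefore lies in the same lift.\<close>
      then have "\<phi> a \<in> N a" "\<phi> a \<in> V'" "\<phi> a \<in> X" using a arc by (auto simp: lift_def)
      then have "\<phi> a \<in> lift X" using id \<open>V' \<subseteq> V\<close> by (auto simp: lift_def)
      then show ?thesis using \<open>\<phi> a \<in> N a\<close> by blast
    qed
  qed
  have "lift A \<subseteq> V - {u}" "lift B \<subseteq> V - {u}" "lift A \<inter> lift B = {}"
    using u id by (auto simp: lift_def)
  moreover have "friendly N (lift A)" "friendly N (lift B)" using fr u by blast+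
  moreover have "N u \<inter> lift A \<noteq> {}" "N u \<inter> lift B \<noteq> {}" using meets u by blast+
  moreover have "u \<in> V" using u \<open>V' \<subseteq> V\<close> by blast
  ultimately show ?thesis using splittableI by metis
qed

section \<open>Minimal unsplittable digraphs\<close>

text \<open>\<open>smaller\<close> is the induction hypothesis. It allows arbitrary arcs on a proper
  subset and out-degrees above 15, so that it applies to contractions.\<close>

locale minimal_unsplittable =
  fixes V :: "'a set" and N :: "'a \<Rightarrow> 'a set"
  assumes finV: "finite V" and neV: "V \<noteq> {}"
    and NV: "v \<in> V \<Longrightarrow> N v \<subseteq> V"
    and irrefl: "v \<in> V \<Longrightarrow> v \<notin> N v"
    and card_N: "v \<in> V \<Longrightarrow> card (N v) = 15"
    and unsplittable: "\<not> splittable V N"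
    and smaller: "V' \<subset> V \<Longrightarrow> V' \<noteq> {} \<Longrightarrow> (\<And>v. v \<in> V' \<Longrightarrow> N' v \<subseteq> V' - {v}) \<Longrightarrow>
      (\<And>v. v \<in> V' \<Longrightarrow> 15 \<le> card (N' v)) \<Longrightarrow> splittable V' N'"
begin

definition preds :: "'a \<Rightarrow> 'a set" where
  "preds y = {x \<in> V. y \<in> N x}"

definition entry :: "'a set \<Rightarrow> 'a set" where
  "entry C = {u \<in> V - C. N u \<inter> C \<noteq> {}}"

lemma finite_sub: "X \<subseteq> V \<Longrightarrow> finite X"
  using finV finite_subset by blast

lemma finite_N: "v \<in> V \<Longrightarrow> finite (N v)"
  using NV finite_sub by blast

lemma finite_preds: "finite (preds y)"
  by (rule finite_sub) (auto simp: preds_def)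

lemma no_split:
  assumes "u \<in> V" "A \<subseteq> V - {u}" "B \<subseteq> V - {u}" "A \<inter> B = {}" "friendly N A" "friendly N B"
  shows "N u \<inter> A = {} \<or> N u \<inter> B = {}"
  using unsplittable splittableI[OF assms] by blast

text \<open>A contraction keeping all out-degrees at least 15 is a smaller instance, and its
  splitting lifts back to \<open>V\<close>.\<close>

lemma no_retraction:
  assumes "V' \<subset> V" "V' \<noteq> {}"
    and "\<And>v. v \<in> V' \<Longrightarrow> \<phi> v = v" "\<And>x. x \<in> V - V' \<Longrightarrow> \<phi> x \<in> N x \<inter> V'"
    and "\<And>v. v \<in> V' \<Longrightarrow> 15 \<le> card (\<phi> ` N v - {v})"
  shows False
proof -
  \<comment> \<open>Parallel arcs merge in the image; loops created by the contraction are
    removed.\<close>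
  define N' where "N' v = \<phi> ` N v - {v}" for v
  have im: "\<phi> v \<in> V'" if "v \<in> V" for v
    using that assms(3)[of v] assms(4)[of v] by (cases "v \<in> V'") auto
  have "splittable V' N'"
  proof (rule smaller[OF assms(1,2)])
    fix v assume v: "v \<in> V'"
    show "N' v \<subseteq> V' - {v}"
      using v assms(1) NV[of v] im by (auto simp: N'_def)
    show "15 \<le> card (N' v)" using assms(5)[OF v] by (simp add: N'_def)
  qed
  then have "splittable V N"
    by (rule splittable_retraction[where \<phi> = \<phi>]) (use assms NV in \<open>auto simp: N'_def\<close>)
  then show False using unsplittable by blast
qed

text \<open>A proper out-closed set would be a smaller instance with unchanged
  out-neighbourhoods.\<close>

lemma no_closed:
  assumes "V' \<subset> V" "V' \<noteq> {}"
  obtains v where "v \<in> V'" "\<not> N v \<subseteq> V'"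
proof (rule ccontr)
  assume "\<not> thesis"
  then have cl: "\<And>v. v \<in> V' \<Longrightarrow> N v \<subseteq> V'" using that by blast
  have "splittable V' N"
  proof (rule smaller[OF assms])
    fix v assume v: "v \<in> V'"
    then have "v \<in> V" using assms by blast
    then show "N v \<subseteq> V' - {v}" "15 \<le> card (N v)" using cl[OF v] irrefl card_N by auto
  qed
  then show False using splittable_mono[of V' N V N] assms unsplittable by blast
qed

lemma card_V: "16 \<le> card V"
proof -
  obtain v where v: "v \<in> V" using neV by blast
  have "card (insert v (N v)) = 16" using v card_N irrefl finite_N by simp
  moreover have "insert v (N v) \<subseteq> V" using v NV by blast
  ultimately show ?thesis using card_mono[OF finV] by metis
qed

lemma N_not_subset: "v \<in> V \<Longrightarrow> finite X \<Longrightarrow> card X \<le> 14 \<Longrightarrow> \<not> N v \<subseteq> X"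
  using card_mono[of X "N v"] card_N[of v] by auto

lemma entry_nonempty:
  assumes "C \<subseteq> V" "C \<noteq> {}" "C \<noteq> V"
  shows "entry C \<noteq> {}"
proof -
  have "V - C \<subset> V" "V - C \<noteq> {}" using assms by blast+
  from no_closed[OF this] obtain v where "v \<in> V - C" "\<not> N v \<subseteq> V - C" by blast
  then show ?thesis using NV unfolding entry_def by blast
qed

text \<open>If \<open>C\<close> had at most 13 vertices, \<open>insert u C\<close> would have at
  most 14 and could contain no out-neighbourhood. So its complement would be friendly and meet
  \<open>N u\<close>.\<close>

lemma friendly_card_ge_14:
  assumes "C \<subseteq> V" "C \<noteq> {}" "friendly N C"
  shows "14 \<le> card C"
proof (rule ccontr)
  assume "\<not> 14 \<le> card C"
  then have small: "card C \<le> 13" by simp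
  have finC: "finite C" using assms finite_sub by blast
  have "C \<noteq> V" using small card_V by auto
  then obtain u where u: "u \<in> V" "u \<notin> C" "N u \<inter> C \<noteq> {}"
    using entry_nonempty assms unfolding entry_def by blast
  have uC: "card (insert u C) \<le> 14" "finite (insert u C)" using small finC u by simp_all
  have "friendly N (V - insert u C)"
    unfolding friendly_def using N_not_subset[OF _ uC(2,1)] NV by blast
  moreover have "N u \<inter> (V - insert u C) \<noteq> {}"
    using N_not_subset[OF _ uC(2,1)] NV u by blast
  ultimately show False
    using no_split[of u C "V - insert u C"] u assms by blast
qed

section \<open>Common in-neighbours and in-degrees\<close>

lemma no_digon: "x \<in> V \<Longrightarrow> y \<in> V \<Longrightarrow> y \<in> N x \<Longrightarrow> x \<notin> N y"
proof
  assume "x \<in> V" "y \<in> V" "y \<in> N x" "x \<in> N y"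
  then have "14 \<le> card {x, y}"
    by (intro friendly_card_ge_14) (auto simp: friendly_def)
  moreover have "card {x, y} \<le> 2" by (simp add: card_insert_if)
  ultimately show False by simp
qed

text \<open>Without a common in-neighbour of \<open>x\<close> and \<open>y\<close>, contracting the
  arc merges no two out-neighbours of any vertex.\<close>

lemma arc_dominated:
  assumes x: "x \<in> V" and y: "y \<in> N x"
  obtains z where "z \<in> V" "x \<in> N z" "y \<in> N z"
proof (rule ccontr)
  assume "\<not> thesis"
  then have undom: "\<And>z. z \<in> V \<Longrightarrow> x \<in> N z \<Longrightarrow> y \<notin> N z" using that by blast
  define \<phi> where "\<phi> = id(x := y)"
  have yV: "y \<in> V" "y \<noteq> x" using x y NV irrefl by blast+
  show False
  proof (rule no_retraction[of "V - {x}" \<phi>])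
    show "V - {x} \<subset> V" "V - {x} \<noteq> {}" using x yV by blast+
    show "\<And>v. v \<in> V - {x} \<Longrightarrow> \<phi> v = v" by (simp add: \<phi>_def)
    show "\<And>v. v \<in> V - (V - {x}) \<Longrightarrow> \<phi> v \<in> N v \<inter> (V - {x})" using y yV by (auto simp: \<phi>_def)
    fix v assume v: "v \<in> V - {x}"
    have "inj_on \<phi> (N v)" using undom v by (auto simp: \<phi>_def inj_on_def)
    then have "card (\<phi> ` N v) = 15" using v card_N by (simp add: card_image)
    \<comment> \<open>A loop could arise only at \<open>y\<close>, from an arc back to
      \<open>x\<close>.\<close>
    moreover have "v \<notin> \<phi> ` N v"
      using no_digon[OF x yV(1) y] irrefl[of v] v by (auto simp: \<phi>_def)
    ultimately show "15 \<le> card (\<phi> ` N v - {v})" by simp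
  qed
qed

lemma preds_nonempty:
  assumes "y \<in> V"
  shows "preds y \<noteq> {}"
proof -
  have "V \<noteq> {y}" using card_V by auto
  then show ?thesis using entry_nonempty[of "{y}"] assms unfolding entry_def preds_def by blast
qed

text \<open>Walking back along dominators never leaves the in-neighbourhood.\<close>

lemma preds_friendly_subset:
  assumes "y \<in> V"
  obtains Y where "Y \<subseteq> preds y" "Y \<noteq> {}" "friendly N Y"
proof -
  have "\<exists>Y\<subseteq>preds y. Y \<noteq> {} \<and> friendly N Y"
  proof (rule friendly_subset_of_in_neighbours[OF finite_preds preds_nonempty[OF assms]])
    fix x assume "x \<in> preds y"
    then have "x \<in> V" "y \<in> N x" by (auto simp: preds_def)
    then obtain z where "z \<in> V" "x \<in> N z" "y \<in> N z" by (rule arc_dominated)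
    then show "\<exists>z\<in>preds y. x \<in> N z" by (auto simp: preds_def)
  qed
  then show thesis using that by blast
qed

lemma preds_card_ge_14: "y \<in> V \<Longrightarrow> 14 \<le> card (preds y)"
proof -
  assume "y \<in> V"
  then obtain Y where Y: "Y \<subseteq> preds y" "Y \<noteq> {}" "friendly N Y" by (rule preds_friendly_subset)
  then have "14 \<le> card Y" by (intro friendly_card_ge_14) (auto simp: preds_def)
  then show ?thesis using card_mono[OF finite_preds Y(1)] by simp
qed

text \<open>Both sides count the arcs, by heads and by tails.\<close>

lemma sum_card_preds: "(\<Sum>y\<in>V. card (preds y)) = 15 * card V"
proof -
  have "(\<Sum>y\<in>V. card (preds y)) = (\<Sum>y\<in>V. \<Sum>x\<in>V. if y \<in> N x then 1 else 0)"
    using finV by (simp add: preds_def sum.If_cases Int_def)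
  also have "\<dots> = (\<Sum>x\<in>V. \<Sum>y\<in>V. if y \<in> N x then 1 else 0)"
    by (rule sum.swap)
  also have "\<dots> = (\<Sum>x\<in>V. card (N x))"
  proof (rule sum.cong[OF refl])
    fix x assume "x \<in> V"
    then have "V \<inter> N x = N x" using NV by blast
    then show "(\<Sum>y\<in>V. if y \<in> N x then 1 else 0) = card (N x)"
      using finV by (simp add: sum.If_cases)
  qed
  also have "\<dots> = 15 * card V" using card_N by simp
  finally show ?thesis .
qed

section \<open>Vertices sending arcs into a friendly set\<close>

text \<open>\<open>Z\<close> is the complement of \<open>insert u C\<close> minus its largest
  friendly subset. As \<open>u\<close> does not split, it has no arc into that subset; a vertex of
  \<open>Z\<close> with such an arc would belong to it.\<close>

lemma entry_trapped:
  assumes "C \<subseteq> V" "friendly N C" "u \<in> entry C"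
  obtains Z where "Z \<subseteq> V - insert u C" "N u \<subseteq> C \<union> Z"
    "\<And>z. z \<in> Z \<Longrightarrow> N z \<subseteq> insert u (C \<union> Z)"
    "\<And>Z'. Z' \<subseteq> Z \<Longrightarrow> Z' \<noteq> {} \<Longrightarrow> \<exists>z\<in>Z'. N z \<inter> Z' = {}"
proof
  define X where "X = V - insert u C"
  let ?Z = "X - core N X"
  have u: "u \<in> V" "u \<notin> C" "N u \<inter> C \<noteq> {}" using assms(3) by (auto simp: entry_def)
  show "?Z \<subseteq> V - insert u C" by (auto simp: X_def)
  have "core N X \<subseteq> X" by (rule core_subset)
  then have "N u \<inter> core N X = {}"
    using no_split[of u C "core N X"] u assms friendly_core[of N X] unfolding X_def by blast
  then show "N u \<subseteq> C \<union> ?Z" using u NV irrefl unfolding X_def by blast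
  show "N z \<subseteq> insert u (C \<union> ?Z)" if "z \<in> ?Z" for z
    using that core_absorbs[of z X N] NV[of z] unfolding X_def by blast
  show "\<exists>z\<in>Z'. N z \<inter> Z' = {}" if "Z' \<subseteq> ?Z" "Z' \<noteq> {}" for Z'
    using sink_outside_core[OF that] by blast
qed

subsection \<open>Friendly sets with 14 vertices\<close>

definition small_friendly :: "'a set \<Rightarrow> bool" where
  "small_friendly C \<longleftrightarrow> C \<subseteq> V \<and> friendly N C \<and> card C = 14"

lemma small_friendlyD:
  assumes "small_friendly C"
  shows "C \<subseteq> V" "friendly N C" "card C = 14" "finite C" "C \<noteq> {}"
  using assms finite_sub by (auto simp: small_friendly_def)

lemma small_friendly_minimal:
  assumes "small_friendly C" "Y \<subseteq> C" "Y \<noteq> {}" "friendly N Y"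
  shows "Y = C"
proof -
  note C = small_friendlyD[OF assms(1)]
  have "14 \<le> card Y" by (rule friendly_card_ge_14) (use assms C in blast)+
  then show ?thesis using C assms(2) card_seteq[of C Y] by simp
qed

lemma small_friendly_pred:
  assumes "small_friendly C" "c \<in> C"
  obtains p where "p \<in> C" "c \<in> N p"
proof -
  note C = small_friendlyD[OF assms(1)]
  have "\<exists>z\<in>C. c \<in> N z"
    by (rule in_neighbour_in_minimal_friendly[OF C(2) assms(2)])
      (use small_friendly_minimal[OF assms(1)] irrefl C assms in blast)+
  then show thesis using that by blast
qed

text \<open>A sink of the trapped set of \<open>u\<close> can only have out-neighbourhood \<open>insert u C\<close>; since it
  determines \<open>u\<close>, a counting argument shows that all entry vertices are of this form.\<close>

lemma entry_small_friendly:
  assumes "small_friendly C" "i \<in> entry C"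
  obtains u where "u \<in> entry C" "N i = insert u C"
proof -
  note C = small_friendlyD[OF assms(1)]
  have ex: "\<exists>z\<in>entry C. N z = insert u C" if u: "u \<in> entry C" for u
  proof -
    obtain Z where Z: "Z \<subseteq> V - insert u C" "N u \<subseteq> C \<union> Z"
      "\<And>z. z \<in> Z \<Longrightarrow> N z \<subseteq> insert u (C \<union> Z)"
      "\<And>Z'. Z' \<subseteq> Z \<Longrightarrow> Z' \<noteq> {} \<Longrightarrow> \<exists>z\<in>Z'. N z \<inter> Z' = {}"
      using entry_trapped[OF C(1,2) u] by blast
    have uV: "u \<in> V" "u \<notin> C" using u by (auto simp: entry_def)
    \<comment> \<open>\<open>N u\<close> has 15 vertices, and \<open>C\<close> holds only 14 of
      them.\<close>
    have "Z \<noteq> {}" using N_not_subset[OF uV(1) C(4)] C(3) Z(2) by auto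
    then obtain z where z: "z \<in> Z" "N z \<inter> Z = {}" using Z(4) by blast
    have "N z \<subseteq> insert u C" using Z(3) z by blast
    moreover have "card (insert u C) = 15" using C uV by simp
    moreover have zV: "z \<in> V" "z \<notin> C" using z Z(1) by blast+
    ultimately have "N z = insert u C" using card_N[of z] C(4) card_seteq by (metis finite_insert order_refl)
    moreover from this have "z \<in> entry C" using zV C(5) by (auto simp: entry_def)
    ultimately show ?thesis by blast
  qed
  then obtain h where h: "\<And>u. u \<in> entry C \<Longrightarrow> h u \<in> entry C \<and> N (h u) = insert u C"
    by metis
  have "inj_on h (entry C)"
  proof (rule inj_onI)
    fix u v assume uv: "u \<in> entry C" "v \<in> entry C" "h u = h v"
    then have "insert u C = insert v C" using h by metis
    then show "u = v" using uv by (auto simp: entry_def)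
  qed
  moreover have "finite (entry C)" by (rule finite_sub) (auto simp: entry_def)
  moreover have "h ` entry C \<subseteq> entry C" using h by blast
  ultimately have "h ` entry C = entry C" using endo_inj_surj by blast
  then obtain u where "u \<in> entry C" "i = h u" using assms(2) by blast
  then show thesis using that h by blast
qed

text \<open>Entry vertices send arcs to all of \<open>C\<close>, so an arc back would form a
  digon.\<close>

lemma small_friendly_no_arc_to_entry:
  assumes "small_friendly C" "c \<in> C"
  shows "N c \<inter> entry C = {}"
proof (rule ccontr)
  assume "N c \<inter> entry C \<noteq> {}"
  then obtain i where i: "i \<in> N c" "i \<in> entry C" by blast
  then obtain u where "N i = insert u C" using entry_small_friendly[OF assms(1)] by blast
  then show False
    using no_digon[of c i] i assms small_friendlyD(1)[OF assms(1)] by (auto simp: entry_def)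
qed

text \<open>\<open>entry C\<close> is itself friendly, hence has at least 14 vertices. With exactly
  14, a perfect matching from \<open>entry C\<close> onto \<open>C\<close> could be contracted
  without lowering any remaining out-degree.\<close>

lemma card_entry_small_friendly:
  assumes sf: "small_friendly C"
  shows "15 \<le> card (entry C)"
proof -
  note C = small_friendlyD[OF sf]
  have EV: "entry C \<subseteq> V" and EC: "entry C \<inter> C = {}" by (auto simp: entry_def)
  have finE: "finite (entry C)" using EV finite_sub by blast
  have "C \<noteq> V" using C(3) card_V by auto
  then have Ene: "entry C \<noteq> {}" using entry_nonempty C by blast
  have "friendly N (entry C)"
    unfolding friendly_def using entry_small_friendly[OF sf] by blast
  then have "14 \<le> card (entry C)" using friendly_card_ge_14 EV Ene by blast
  moreover have "card (entry C) \<noteq> 14"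
  proof
    assume "card (entry C) = 14"
    then obtain f where f: "bij_betw f (entry C) C"
      using finite_same_card_bij[OF finE C(4)] C(3) by auto
    \<comment> \<open>The matched pairs are arcs because every entry vertex dominates
      \<open>C\<close>.\<close>
    define \<phi> where "\<phi> x = (if x \<in> entry C then f x else x)" for x
    show False
    proof (rule no_retraction[of "V - entry C" \<phi>])
      show "V - entry C \<subset> V" using EV Ene by blast
      show "V - entry C \<noteq> {}" using C(1,5) EC by blast
      show "\<And>v. v \<in> V - entry C \<Longrightarrow> \<phi> v = v" by (simp add: \<phi>_def)
      show "\<phi> x \<in> N x \<inter> (V - entry C)" if "x \<in> V - (V - entry C)" for x
      proof -
        have x: "x \<in> entry C" using that by blast
        then have "f x \<in> C" using f by (auto simp: bij_betw_def)
        moreover obtain u where "N x = insert u C" using entry_small_friendly[OF sf x] by blast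
        ultimately show ?thesis using x C(1) EC by (auto simp: \<phi>_def)
      qed
      fix v assume v: "v \<in> V - entry C"
      show "15 \<le> card (\<phi> ` N v - {v})"
      proof (cases "v \<in> C")
        case True
        then have "\<phi> ` N v = N v"
          using small_friendly_no_arc_to_entry[OF sf True] by (force simp: \<phi>_def)
        then show ?thesis using v card_N irrefl by simp
      next
        case False
        then have NC: "N v \<inter> C = {}" using v by (auto simp: entry_def)
        have fC: "f x \<in> C" if "x \<in> entry C" for x using f that by (auto simp: bij_betw_def)
        \<comment> \<open>\<open>N v\<close> avoids \<open>C\<close>, so moved vertices cannot
          collide with fixed ones.\<close>
        have "inj_on \<phi> (N v)"
        proof (rule inj_onI)
          fix a b assume ab: "a \<in> N v" "b \<in> N v" "\<phi> a = \<phi> b"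
          have "inj_on f (entry C)" using f by (simp add: bij_betw_def)
          then show "a = b"
            using ab NC fC by (auto simp: \<phi>_def split: if_splits dest: inj_onD)
        qed
        then have "card (\<phi> ` N v) = 15" using v card_N by (simp add: card_image)
        moreover have "v \<notin> \<phi> ` N v"
          using fC False irrefl[of v] v by (auto simp: \<phi>_def)
        ultimately show ?thesis by simp
      qed
    qed
  qed
  ultimately show ?thesis by simp
qed

text \<open>All entry vertices, at least 15, dominate \<open>c\<close>, and \<open>c\<close> has one
  more in-neighbour inside \<open>C\<close>.\<close>

lemma card_preds_small_friendly:
  assumes sf: "small_friendly C" and c: "c \<in> C"
  shows "16 \<le> card (preds c)"
proof -
  note C = small_friendlyD[OF sf]
  obtain p where p: "p \<in> C" "c \<in> N p" using small_friendly_pred[OF sf c] .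
  have "finite (entry C)" by (rule finite_sub) (auto simp: entry_def)
  moreover have "p \<notin> entry C" using p by (simp add: entry_def)
  ultimately have "16 \<le> card (insert p (entry C))"
    using card_entry_small_friendly[OF sf] by simp
  moreover have "insert p (entry C) \<subseteq> preds c"
  proof -
    have "c \<in> N i" if "i \<in> entry C" for i
      using entry_small_friendly[OF sf that] c by blast
    then show ?thesis using p C(1) unfolding preds_def entry_def by blast
  qed
  ultimately show ?thesis using card_mono[OF finite_preds] order_trans by blast
qed

text \<open>By minimality some \<open>c\<close> in the intersection has no in-neighbour there. Its
  in-neighbours \<open>p\<close> in \<open>C'\<close> and \<open>q\<close> in \<open>C\<close> are
  entry vertices of the respective other set, so they dominate each other.\<close>

lemma small_friendly_disjoint:
  assumes sf: "small_friendly C" "small_friendly C'" and "C \<inter> C' \<noteq> {}"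
  shows "C = C'"
proof (rule ccontr)
  assume neq: "C \<noteq> C'"
  note C = small_friendlyD[OF sf(1)] and C' = small_friendlyD[OF sf(2)]
  have "\<not> (\<forall>c\<in>C \<inter> C'. \<exists>z\<in>C \<inter> C'. c \<in> N z)"
  proof
    assume "\<forall>c\<in>C \<inter> C'. \<exists>z\<in>C \<inter> C'. c \<in> N z"
    then have "\<exists>Y\<subseteq>C \<inter> C'. Y \<noteq> {} \<and> friendly N Y"
      using assms(3) C(4) by (intro friendly_subset_of_in_neighbours) auto
    then obtain Y where "Y \<subseteq> C" "Y \<subseteq> C'" "Y \<noteq> {}" "friendly N Y" by blast
    then show False using small_friendly_minimal sf neq by metis
  qed
  then obtain c where c: "c \<in> C" "c \<in> C'" "\<And>z. z \<in> C \<inter> C' \<Longrightarrow> c \<notin> N z" by blast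
  obtain q where q: "q \<in> C" "c \<in> N q" using small_friendly_pred[OF sf(1) c(1)] .
  obtain p where p: "p \<in> C'" "c \<in> N p" using small_friendly_pred[OF sf(2) c(2)] .
  have "p \<in> entry C" "q \<in> entry C'"
    using p q c C(1) C'(1) unfolding entry_def by blast+
  then have "q \<in> N p" "p \<in> N q"
    using entry_small_friendly[OF sf(1)] entry_small_friendly[OF sf(2)] p(1) q(1) by blast+
  then show False using no_digon[of p q] p q C(1) C'(1) by blast
qed

text \<open>Some \<open>z\<close> in \<open>C\<close> is a common in-neighbour of \<open>y\<close>
  and an out-neighbour \<open>x\<close> of \<open>y\<close>. Its 15 out-neighbours include all the
  counted vertices, \<open>x\<close>, and a vertex of \<open>C\<close>.\<close>

lemma card_same_preds:
  assumes sf: "small_friendly C"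
  shows "card {y \<in> V. preds y = C} \<le> 13"
proof (cases "{y \<in> V. preds y = C} = {}")
  case True
  then show ?thesis by (metis card.empty zero_le)
next
  case False
  let ?Y = "{y \<in> V. preds y = C}"
  note C = small_friendlyD[OF sf]
  from False obtain y where y: "y \<in> V" "preds y = C" by blast
  have "N y \<noteq> {}" using N_not_subset[OF y(1), of "{}"] by auto
  then obtain x where x: "x \<in> N y" by blast
  have xV: "x \<in> V" using x y NV by blast
  obtain z where z: "z \<in> V" "y \<in> N z" "x \<in> N z" using arc_dominated[OF y(1) x] .
  have zC: "z \<in> C" using z y by (auto simp: preds_def)
  obtain c where c: "c \<in> C" "c \<in> N z" using zC C(2) unfolding friendly_def by blast
  have YC: "?Y \<inter> C = {}" using irrefl by (auto simp: preds_def)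
  have "x \<notin> C" using no_digon[OF y(1) xV x] y(2) by (auto simp: preds_def)
  moreover have "x \<notin> ?Y" using YC x y by (auto simp: preds_def)
  ultimately have "card (insert c (insert x ?Y)) = card ?Y + 2"
    using YC c finV by (subst card_insert_disjoint; auto)+
  moreover have "insert c (insert x ?Y) \<subseteq> N z"
    using c z zC by (auto simp: preds_def)
  ultimately have "card ?Y + 2 \<le> 15"
    using card_mono[OF finite_N[OF z(1)]] card_N[OF z(1)] by metis
  then show ?thesis by simp
qed

text \<open>Double counting of the arcs: each 14-vertex friendly set carries a surplus of at least 14
  in its in-degrees, which pays for the at most 13 vertices of in-degree 14 assigned to it.\<close>

lemma no_small_friendly: "\<not> small_friendly C"
proof
  assume sf: "small_friendly C"
  define F where "F = {C. small_friendly C}"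
  define M where "M = \<Union>F"
  define \<Delta> where "\<Delta> = {y \<in> V. card (preds y) = 14}"
  have FV: "F \<subseteq> Pow V" by (auto simp: F_def small_friendly_def)
  then have finF: "finite F" using finV finite_subset by blast
  have MV: "M \<subseteq> V" using FV by (auto simp: M_def)
  have "card M = (\<Sum>C\<in>F. card C)"
    unfolding M_def
  proof (rule card_Union_disjoint)
    show "pairwise disjnt F"
      using small_friendly_disjoint by (auto simp: pairwise_def disjnt_def F_def)
    show "\<And>A. A \<in> F \<Longrightarrow> finite A" using FV finite_sub by blast
  qed
  also have "\<dots> = 14 * card F"
    by (simp add: F_def small_friendly_def)
  finally have cM: "card M = 14 * card F" .
  \<comment> \<open>An in-neighbourhood with 14 vertices equals the friendly set it
    contains.\<close>
  have "\<Delta> \<subseteq> (\<Union>C\<in>F. {y \<in> V. preds y = C})"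
  proof
    fix y assume y: "y \<in> \<Delta>"
    then have yV: "y \<in> V" and cy: "card (preds y) = 14" by (auto simp: \<Delta>_def)
    obtain Y where Y: "Y \<subseteq> preds y" "Y \<noteq> {}" "friendly N Y"
      using preds_friendly_subset[OF yV] .
    have pV: "preds y \<subseteq> V" by (auto simp: preds_def)
    have "14 \<le> card Y" using friendly_card_ge_14 Y pV by blast
    then have "Y = preds y" using card_seteq[OF finite_preds Y(1)] cy by simp
    then have "preds y \<in> F" using Y pV cy by (auto simp: F_def small_friendly_def)
    then show "y \<in> (\<Union>C\<in>F. {y \<in> V. preds y = C})" using yV by blast
  qed
  then have "card \<Delta> \<le> card (\<Union>C\<in>F. {y \<in> V. preds y = C})"
    using finF finV by (intro card_mono) auto
  also have "\<dots> \<le> (\<Sum>C\<in>F. card {y \<in> V. preds y = C})"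
    by (rule card_UN_le[OF finF])
  also have "\<dots> \<le> (\<Sum>C\<in>F. 13)"
    by (rule sum_mono) (use card_same_preds in \<open>auto simp: F_def\<close>)
  finally have c\<Delta>: "card \<Delta> \<le> 13 * card F" by simp
  \<comment> \<open>In-degrees are at least 16 on \<open>M\<close>, 14 on \<open>\<Delta>\<close>
    and 15 elsewhere; the deficit is moved to the right to avoid natural subtraction.\<close>
  have ge: "15 + of_bool (y \<in> M) \<le> card (preds y) + of_bool (y \<in> \<Delta>)" if "y \<in> V" for y
  proof (cases "y \<in> M")
    case True
    then have "16 \<le> card (preds y)" using card_preds_small_friendly by (auto simp: M_def F_def)
    then show ?thesis using True by simp
  next
    case False
    then show ?thesis using preds_card_ge_14[OF that] that by (auto simp: \<Delta>_def)
  qed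
  have "(\<Sum>y\<in>V. 15 + of_bool (y \<in> M)) \<le> (\<Sum>y\<in>V. card (preds y) + of_bool (y \<in> \<Delta>))"
    by (rule sum_mono) (rule ge)
  moreover have "(\<Sum>y\<in>V. of_bool (y \<in> M)) = card M" "(\<Sum>y\<in>V. of_bool (y \<in> \<Delta>)) = card \<Delta>"
    using finV MV by (auto simp: \<Delta>_def Int_absorb1 Int_def intro!: arg_cong[where f = card])
  ultimately have "card M \<le> card \<Delta>"
    using sum_card_preds by (simp add: sum.distrib)
  \<comment> \<open>Here \<open>14 * card F\<close> is at most \<open>13 * card F\<close>.\<close>
  then have "card F = 0" using cM c\<Delta> by simp
  then show False using sf finF by (auto simp: F_def)
qed

subsection \<open>The 15-regular case\<close>

lemma friendly_card_ge_15:
  assumes "C \<subseteq> V" "C \<noteq> {}" "friendly N C"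
  shows "15 \<le> card C"
  using friendly_card_ge_14[OF assms] no_small_friendly[of C] assms(1,3)
  by (simp add: small_friendly_def)

text \<open>Each in-neighbourhood contains a friendly set with at least 15 vertices, while
  in-degrees average 15. So equality holds and the friendly set is the whole
  in-neighbourhood.\<close>

lemma preds_eq_friendly:
  assumes "y \<in> V"
  shows "card (preds y) = 15" "friendly N (preds y)"
proof -
  have sub: "\<exists>Y\<subseteq>preds v. friendly N Y \<and> 15 \<le> card Y" if v: "v \<in> V" for v
  proof -
    obtain Y where Y: "Y \<subseteq> preds v" "Y \<noteq> {}" "friendly N Y"
      using preds_friendly_subset[OF v] .
    moreover have "Y \<subseteq> V" using Y(1) by (auto simp: preds_def)
    ultimately have "15 \<le> card Y" by (intro friendly_card_ge_15)
    then show ?thesis using Y by blast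
  qed
  have ge: "15 \<le> card (preds v)" if "v \<in> V" for v
  proof -
    obtain Y where "Y \<subseteq> preds v" "15 \<le> card Y" using sub[OF \<open>v \<in> V\<close>] by blast
    then show ?thesis using card_mono[OF finite_preds, of Y v] by simp
  qed
  show eq: "card (preds y) = 15"
  proof (rule ccontr)
    assume "card (preds y) \<noteq> 15"
    then have "15 < card (preds y)" using ge[OF assms] by simp
    then have "(\<Sum>v\<in>V. 15) < (\<Sum>v\<in>V. card (preds v))"
      using ge assms finV by (intro sum_strict_mono_ex1) auto
    then show False using sum_card_preds by simp
  qed
  obtain Y where Y: "Y \<subseteq> preds y" "friendly N Y" "15 \<le> card Y" using sub[OF assms] by blast
  then have "Y = preds y" using card_seteq[OF finite_preds Y(1)] eq by simp
  then show "friendly N (preds y)" using Y by simp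
qed

lemma preds_minimal:
  assumes "y \<in> V" "Y \<subset> preds y" "Y \<noteq> {}"
  shows "\<not> friendly N Y"
proof
  assume "friendly N Y"
  moreover have "Y \<subseteq> V" using assms(2) by (auto simp: preds_def)
  ultimately have "15 \<le> card Y" using friendly_card_ge_15[OF _ assms(3)] by simp
  then show False
    using psubset_card_mono[OF finite_preds assms(2)] preds_eq_friendly(1)[OF assms(1)] by simp
qed

text \<open>In-neighbourhoods are minimal friendly sets, so in-neighbours within them are unique:
  the ends of an arc have only one common in-neighbour.\<close>

lemma unique_dominator:
  assumes "y \<in> V" "x \<in> preds y" "a \<in> preds y" "b \<in> preds y" "x \<in> N a" "x \<in> N b"
  shows "a = b"
proof (rule unique_in_neighbour_in_minimal_friendly[OF finite_preds preds_eq_friendly(2)[OF assms(1)]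
      _ _ assms(2-6)])
  show "\<not> friendly N Y" if "Y \<subset> preds y" "Y \<noteq> {}" for Y
    using preds_minimal[OF assms(1) that] .
  show "v \<notin> N v" if "v \<in> preds y" for v
    using that irrefl by (simp add: preds_def)
qed

text \<open>A vertex missing at most two vertices of the cycle \<open>C\<close> dominates all but four of its 15
  arcs, so two such vertices would have to dominate a common arc.\<close>

lemma unique_almost_dominating:
  assumes y: "y \<in> V" and C: "C = preds y"
    and zz: "z \<in> V" "z' \<in> V" "card (C - N z) \<le> 2" "card (C - N z') \<le> 2"
  shows "z = z'"
proof -
  have CV: "C \<subseteq> V" and finC: "finite C" and cC: "card C = 15" and frC: "friendly N C"
    using C preds_eq_friendly[OF y] finite_preds by (auto simp: preds_def)
  have "\<exists>p\<in>C. x \<in> N p" if "x \<in> C" for x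
    by (rule in_neighbour_in_minimal_friendly[OF frC that])
      (use preds_minimal[OF y] C irrefl CV that in auto)
  then obtain g where g: "\<And>x. x \<in> C \<Longrightarrow> g x \<in> C \<and> x \<in> N (g x)" by metis
  have "inj_on g C"
  proof -
    have "g ` C = C"
    proof (rule ccontr)
      assume "g ` C \<noteq> C"
      then have sub: "g ` C \<subset> C" using g by blast
      have "\<exists>Y\<subseteq>g ` C. Y \<noteq> {} \<and> friendly N Y"
        by (rule friendly_subset_of_in_neighbours) (use finC cC g in auto)
      then obtain Y where Y: "Y \<subseteq> g ` C" "Y \<noteq> {}" "friendly N Y" by blast
      have "Y \<subset> preds y" using Y(1) sub C by blast
      then show False using preds_minimal[OF y _ Y(2)] Y(3) by blast
    qed
    then show ?thesis using finC by (simp add: eq_card_imp_inj_on)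
  qed
  \<comment> \<open>These \<open>x\<close> index the cycle arcs from \<open>g x\<close> to
    \<open>x\<close> with an end missed by \<open>w\<close>; each missed vertex spoils at most two
    arcs.\<close>
  define bad where "bad w = {x \<in> C. x \<notin> N w \<or> g x \<notin> N w}" for w
  have card_bad: "card (bad w) \<le> 4" if w: "card (C - N w) \<le> 2" for w
  proof -
    let ?B = "{x \<in> C. g x \<notin> N w}"
    have "card ?B = card (g ` ?B)"
      using \<open>inj_on g C\<close> by (intro card_image[symmetric]) (auto intro: inj_on_subset)
    also have "\<dots> \<le> card (C - N w)"
      using g finC by (intro card_mono) auto
    finally have "card ?B \<le> 2" using w by simp
    moreover have "bad w = (C - N w) \<union> ?B" by (auto simp: bad_def)
    ultimately show ?thesis using w card_Un_le[of "C - N w" ?B] by simp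
  qed
  have "card (bad z \<union> bad z') \<le> 8"
    using card_Un_le[of "bad z" "bad z'"] card_bad[OF zz(3)] card_bad[OF zz(4)] by simp
  then have "\<not> C \<subseteq> bad z \<union> bad z'"
    using card_mono[of "bad z \<union> bad z'" C] finC cC by (auto simp: bad_def)
  then obtain x where x: "x \<in> C" "x \<in> N z" "x \<in> N z'" "g x \<in> N z" "g x \<in> N z'"
    by (auto simp: bad_def)
  show ?thesis
    \<comment> \<open>Uniqueness is applied in the in-neighbourhood of \<open>x\<close>, not of
      \<open>y\<close>.\<close>
    by (rule unique_dominator[of x "g x"]) (use x g[OF x(1)] CV zz in \<open>auto simp: preds_def\<close>)
qed

text \<open>At most one vertex misses two or fewer vertices of \<open>C\<close>, so some entry
  vertex \<open>u\<close> misses more. Peeling sinks off its trapped set yields vertices missing few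
  of \<open>C\<close>, so that set is a single vertex and \<open>u\<close> misses few after
  all.\<close>

lemma contradiction: False
proof -
  obtain y where y: "y \<in> V" using neV by blast
  define C where "C = preds y"
  have CV: "C \<subseteq> V" and finC: "finite C" and cC: "card C = 15" and frC: "friendly N C"
    using preds_eq_friendly[OF y] finite_preds by (auto simp: C_def preds_def)
  have uniq: "z = z'" if "z \<in> V" "z' \<in> V" "card (C - N z) \<le> 2" "card (C - N z') \<le> 2" for z z'
    using unique_almost_dominating[OF y C_def] that by blast
  \<comment> \<open>Since \<open>C\<close> and \<open>N z\<close> both have 15 vertices,
    \<open>z\<close> misses as many vertices of \<open>C\<close> as it has out-neighbours
    outside.\<close>
  have miss: "card (C - N z) \<le> k" if "z \<in> V" "N z \<subseteq> C \<union> X" "finite X" "card X \<le> k" for z X k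
  proof -
    have "15 \<le> card (N z \<inter> C) + card X"
    proof -
      have "N z \<subseteq> (N z \<inter> C) \<union> X" using that by blast
      then have "card (N z) \<le> card ((N z \<inter> C) \<union> X)"
        using that finC by (intro card_mono) auto
      then show ?thesis using card_N[OF that(1)] card_Un_le[of "N z \<inter> C" X] by simp
    qed
    moreover have "card (C - N z) = 15 - card (N z \<inter> C)"
      using card_Diff_subset_Int[of C "N z"] finC cC by (simp add: Int_commute)
    ultimately show ?thesis using that(4) by simp
  qed
  obtain c where c: "c \<in> C" using cC by fastforce
  have "card (preds c \<inter> C) \<le> 1"
  proof -
    have "a = b" if "a \<in> preds c \<inter> C" "b \<in> preds c \<inter> C" for a b
      by (rule unique_dominator[OF y, of c]) (use that c in \<open>auto simp: C_def preds_def\<close>)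
    then show ?thesis by (auto simp: card_le_Suc0_iff_eq finC)
  qed
  then have "2 \<le> card (preds c - C)"
    using card_Diff_subset_Int[of "preds c" C] finC preds_eq_friendly(1)[of c] c CV by auto
  then obtain u1 u2 where "u1 \<in> preds c - C" "u2 \<in> preds c - C" "u1 \<noteq> u2"
    by (metis card_le_Suc0_iff_eq finite_preds finite_Diff not_less_eq_eq numeral_2_eq_2)
  then have "u1 \<in> entry C" "u2 \<in> entry C" "u1 \<noteq> u2"
    using c by (auto simp: entry_def preds_def)
  then obtain u where u: "u \<in> entry C" "\<not> card (C - N u) \<le> 2"
    using uniq[of u1 u2] by (auto simp: entry_def)
  have uV: "u \<in> V" using u by (simp add: entry_def)
  obtain Z where Z: "Z \<subseteq> V - insert u C" "N u \<subseteq> C \<union> Z"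
    "\<And>z. z \<in> Z \<Longrightarrow> N z \<subseteq> insert u (C \<union> Z)"
    "\<And>Z'. Z' \<subseteq> Z \<Longrightarrow> Z' \<noteq> {} \<Longrightarrow> \<exists>z\<in>Z'. N z \<inter> Z' = {}"
    using entry_trapped[OF CV frC u(1)] by blast
  have "Z \<noteq> {}" using miss[OF uV, of "{}" 2] Z(2) u(2) by auto
  then obtain z1 where z1: "z1 \<in> Z" "N z1 \<inter> Z = {}" using Z(4) by blast
  have few1: "card (C - N z1) \<le> 2"
    using miss[of z1 "{u}" 2] z1 Z(1) Z(3)[OF z1(1)] by auto
  have "Z = {z1}"
  proof (rule ccontr)
    assume "Z \<noteq> {z1}"
    then have "Z - {z1} \<noteq> {}" using z1 by blast
    then obtain z2 where z2: "z2 \<in> Z - {z1}" "N z2 \<inter> (Z - {z1}) = {}"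
      using Z(4)[of "Z - {z1}"] by blast
    \<comment> \<open>A second sink can leave \<open>C\<close> only towards \<open>u\<close> and
      \<open>z1\<close>, so it too misses at most two.\<close>
    have "N z2 \<subseteq> C \<union> {u, z1}" using Z(3)[of z2] z2 by blast
    moreover have "card {u, z1} \<le> 2" by (simp add: card_insert_if)
    moreover have "z2 \<in> V" using z2 Z(1) by blast
    ultimately have "card (C - N z2) \<le> 2" by (intro miss[of z2 "{u, z1}" 2]) simp_all
    then show False using uniq[of z1 z2] few1 z1 z2 Z(1) by blast
  qed
  then show False using miss[OF uV, of "{z1}" 2] Z(2) u(2) by auto
qed

end

section \<open>Reduction to the minimal case\<close>

text \<open>Deleting arcs makes all out-degrees exactly 15, and a splitting persists when the arcs
  are restored. The induction is over all arc sets, as \<open>smaller\<close> requires.\<close>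

lemma splittable_of_min_out_degree:
  assumes "finite V" "V \<noteq> {}" "\<And>v. v \<in> V \<Longrightarrow> N v \<subseteq> V - {v}" "\<And>v. v \<in> V \<Longrightarrow> 15 \<le> card (N v)"
  shows "splittable V N"
  using assms
proof (induction V arbitrary: N rule: finite_psubset_induct)
  case (psubset V)
  have "\<forall>v\<in>V. \<exists>T\<subseteq>N v. card T = 15"
    using psubset.prems(3) by (meson obtain_subset_with_card_n)
  then obtain T where T: "\<And>v. v \<in> V \<Longrightarrow> T v \<subseteq> N v \<and> card (T v) = 15" by metis
  have "splittable V T"
  proof (rule ccontr)
    assume un: "\<not> splittable V T"
    have "minimal_unsplittable V T"
    proof
      show "splittable V' N'" if "V' \<subset> V" "V' \<noteq> {}" "\<And>v. v \<in> V' \<Longrightarrow> N' v \<subseteq> V' - {v}"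
        "\<And>v. v \<in> V' \<Longrightarrow> 15 \<le> card (N' v)" for V' N'
        using psubset.IH[OF that(1,2)] that by blast
      fix v assume v: "v \<in> V"
      then have "T v \<subseteq> V - {v}" using T psubset.prems(2) by blast
      then show "T v \<subseteq> V" "v \<notin> T v" by blast+
      show "card (T v) = 15" using T v by blast
    qed (fact psubset.hyps psubset.prems(1) un)+
    then show False by (rule minimal_unsplittable.contradiction)
  qed
  then show ?case by (rule splittable_mono) (use T in auto)
qed

section \<open>Friendly partitions\<close>

text \<open>\<open>A'\<close> is the largest friendly subset of \<open>X - B\<close>. A vertex
  outside both \<open>A'\<close> and \<open>B\<close> has no arc into \<open>A'\<close>, so its
  out-neighbours in \<open>X\<close> lie in the remainder.\<close>

lemma extend_friendly_pair:
  assumes "A \<subseteq> X" "B \<subseteq> X" "A \<inter> B = {}" "friendly N A" "friendly N B" "friendly N X"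
  obtains A' B' where "A \<subseteq> A'" "B \<subseteq> B'" "A' \<inter> B' = {}" "A' \<union> B' = X" "friendly N A'" "friendly N B'"
proof
  let ?A = "core N (X - B)"
  have sub: "?A \<subseteq> X - B" by (rule core_subset)
  show "A \<subseteq> ?A" using core_greatest[of A "X - B" N] assms by blast
  show "B \<subseteq> X - ?A" "?A \<inter> (X - ?A) = {}" "?A \<union> (X - ?A) = X" using sub assms by blast+
  show "friendly N ?A" by (rule friendly_core)
  show "friendly N (X - ?A)"
    unfolding friendly_def
  proof
    fix v assume v: "v \<in> X - ?A"
    show "N v \<inter> (X - ?A) \<noteq> {}"
    proof (cases "v \<in> B")
      case True
      then show ?thesis using assms(2,5) sub unfolding friendly_def by blast
    next
      case False
      then show ?thesis
        using core_absorbs[of v "X - B" N] v assms(6) unfolding friendly_def by blast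
    qed
  qed
qed

lemma friendly_partition_pair:
  assumes "A \<noteq> {}" "B \<noteq> {}" "A \<inter> B = {}" "A \<union> B = verts G"
    and "friendly (\<lambda>v. {x. v \<rightarrow>\<^bsub>G\<^esub> x}) A" "friendly (\<lambda>v. {x. v \<rightarrow>\<^bsub>G\<^esub> x}) B"
  shows "friendly_partition G {A, B}"
proof -
  have "A \<noteq> B" using assms by blast
  moreover have "partition_on (verts G) {A, B}"
    using assms by (auto simp: partition_on_def disjoint_def)
  ultimately show ?thesis
    using assms(5,6) unfolding friendly_partition_def friendly_def by auto
qed

theorem theorem1p6:
  fixes G :: "('a, 'b) pre_digraph"
  assumes "digraph G"
    and "verts G \<noteq> {}"
    and "\<forall>v\<in>verts G. out_degree G v \<ge> 15"
  shows "\<exists>u\<in>verts G. \<forall>w\<in>verts G - {u}. \<exists>P. friendly_partition G P \<and> separates P u w"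
proof -
  interpret digraph G by fact
  define N where "N v = {x. v \<rightarrow>\<^bsub>G\<^esub> x}" for v
  have NV: "N v \<subseteq> verts G - {v}" for v
    using adj_not_same by (auto simp: N_def)
  have card_N: "15 \<le> card (N v)" if "v \<in> verts G" for v
  proof -
    have "N v = head G ` out_arcs G v"
      by (auto simp: N_def out_arcs_def arcs_ends_def arc_to_ends_def)
    moreover have "inj_on (head G) (out_arcs G v)"
      by (rule inj_onI) (auto simp: arc_to_ends_def intro: no_multi_arcs)
    ultimately show ?thesis using assms(3) that by (simp add: card_image out_degree_def)
  qed
  have "splittable (verts G) N"
    by (rule splittable_of_min_out_degree) (use assms(2) NV card_N in auto)
  then obtain u A B where u: "u \<in> verts G" "A \<subseteq> verts G - {u}" "B \<subseteq> verts G - {u}" "A \<inter> B = {}"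
    "friendly N A" "friendly N B" "N u \<inter> A \<noteq> {}" "N u \<inter> B \<noteq> {}"
    unfolding splittable_def by blast
  \<comment> \<open>Removing \<open>u\<close> costs each vertex at most one of its 15 or more
    out-neighbours.\<close>
  have "friendly N (verts G - {u})"
    unfolding friendly_def
  proof
    fix v assume v: "v \<in> verts G - {u}"
    show "N v \<inter> (verts G - {u}) \<noteq> {}"
    proof
      assume "N v \<inter> (verts G - {u}) = {}"
      then have "N v \<subseteq> {u}" using NV[of v] by blast
      then have "card (N v) \<le> 1" using card_mono[of "{u}" "N v"] by simp
      then show False using card_N[of v] v by simp
    qed
  qed
  then obtain A' B' where AB: "A \<subseteq> A'" "B \<subseteq> B'" "A' \<inter> B' = {}" "A' \<union> B' = verts G - {u}"
    "friendly N A'" "friendly N B'"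
    using extend_friendly_pair[OF u(2-6)] by blast
  \<comment> \<open>\<open>u\<close> joins the part not containing \<open>w\<close>, where it has an
    out-neighbour.\<close>
  have key: "\<exists>P. friendly_partition G P \<and> separates P u w"
    if "w \<in> X" "X \<inter> Y = {}" "X \<union> Y = verts G - {u}" "friendly N X" "friendly N Y" "N u \<inter> Y \<noteq> {}"
    for w X Y
  proof (intro exI conjI)
    have "friendly N (insert u Y)" using that unfolding friendly_def by blast
    then show "friendly_partition G {X, insert u Y}"
      using that u(1) unfolding N_def by (intro friendly_partition_pair) auto
    have "X \<noteq> insert u Y" using that by blast
    then show "separates {X, insert u Y} u w" using that(1) unfolding separates_def by auto
  qed
  have "\<exists>P. friendly_partition G P \<and> separates P u w" if "w \<in> verts G - {u}" for w
  proof (cases "w \<in> A'")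
    case True
    then show ?thesis using key[of w A' B'] AB u by blast
  next
    case False
    then show ?thesis using key[of w B' A'] AB u that by blast
  qed
  then show ?thesis using u(1) by blast
qed

end
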